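(* Let $n\ge2$ and let $FSQ_n$ be the free oriented singquandle generated by $x_1,\dots,x_n$. The map $\Phi:SB_n\to\operatorname{End}(FSQ_n)$ defined on the generators of the singular braid monoid by $$\Phi(\sigma_i):\ x_i\mapsto x_{i+1},\quad x_{i+1}\mapsto x_i*x_{i+1},\quad x_j\mapsto x_j\ (j\ne i,i+1),$$ $$\Phi(\tau_i):\ x_i\mapsto x_i\circ_l x_{i+1},\quad x_{i+1}\mapsto x_i\circ_r x_{i+1},\quad x_j\mapsto x_j\ (j\ne i,i+1),$$ for $i=1,\dots,n-1$ (with $\Phi(\sigma_i^{-1})=\Phi(\sigma_i)^{-1}$) is a representation, i.e. a well-defined monoid homomorphism from $SB_n$ to the monoid of endomorphisms of $FSQ_n$.
   Context: The singular braid monoid $SB_n$ is the monoid generated by $\sigma_i,\sigma_i^{-1},\tau_i$, $i=1,\dots,n-1$, with defining relations: $\sigma_i\sigma_i^{-1}=\sigma_i^{-1}\sigma_i=e$; $\sigma_i\sigma_{i+1}\sigma_i=\sigma_{i+1}\sigma_i\sigma_{i+1}$ ($1\le i\le n-2$); $\sigma_i\sigma_j=\sigma_j\sigma_i$, $\tau_i\tau_j=\tau_j\tau_i$, $\tau_i\sigma_j=\sigma_j\tau_i$ for $|i-j|\ge2$; $\tau_i\sigma_i=\sigma_i\tau_i$ ($1\le i\le n-1$); $\sigma_i\sigma_{i+1}\tau_i=\tau_{i+1}\sigma_i\sigma_{i+1}$ and $\sigma_{i+1}\sigma_i\tau_{i+1}=\tau_i\sigma_{i+1}\sigma_i$ ($1\le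 i\le n-2$). A quandle is a non-empty set $Q$ with a binary operation $*$ such that $x*x=x$; for any $x,y\in Q$ there is a unique $z\in Q$ with $x=z*y$ (this $z$ is denoted $x\,\bar{*}\,y$); and $(x*y)*z=(x*z)*(y*z)$. An oriented singquandle $(X,*,\circ_l,\circ_r)$ is a set with three binary operations such that $(X,* )$ is a quandle and for all $x,y,z\in X$: $(x\circ_l y)*z=(x*z)\circ_l(y*z)$; $(x\circ_r y)*z=(x*z)\circ_r(y*z)$; $(x\circ_l y)\,\bar{*}\,z=(x\,\bar{*}\,z)\circ_l(y\,\bar{*}\,z)$; $(x\circ_r y)\,\bar{*}\,z=(x\,\bar{*}\,z)\circ_r(y\,\bar{*}\,z)$; $(y\,\bar{*}\,(x\circ_l z))*x=(y*(x\circ_r z))\,\bar{*}\,z$; $x\circ_r y=y\circ_l(x*y)$; $(x\circ_l y)*(x\circ_r y)=y\circ_r(x*y)$. $FSQ_n$ is the free object on $x_1,\dots,x_n$ in the class of oriented singquandles (an equational class in the operations $*,\bar{*},\circ_l,\circ_r$); an endomorphism is a self-map preserving all these operations, and it is determined by arbitrary images of the generators $x_1,\dots,x_n$. *)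

theory Defs
  imports "HOL-Algebra.Group"
begin

section \<open>The singular braid monoid\<close>

datatype sb_letter = Sig nat | SigInv nat | Tau nat

primrec sb_index :: "sb_letter \<Rightarrow> nat" where
  "sb_index (Sig i) = i"
| "sb_index (SigInv i) = i"
| "sb_index (Tau i) = i"

definition sb_words :: "nat \<Rightarrow> sb_letter list set" where
  "sb_words n = {w. sb_index ` set w \<subseteq> {1..<n}}"

inductive_set sb_rel :: "nat \<Rightarrow> (sb_letter list \<times> sb_letter list) set" for n where
  sig_inv: "i \<in> {1..<n} \<Longrightarrow> ([Sig i, SigInv i], []) \<in> sb_rel n"
| inv_sig: "i \<in> {1..<n} \<Longrightarrow> ([SigInv i, Sig i], []) \<in> sb_rel n"
| braid: "\<lbrakk>1 \<le> i; i + 2 \<le> n\<rbrakk> \<Longrightarrow>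
    ([Sig i, Sig (i + 1), Sig i], [Sig (i + 1), Sig i, Sig (i + 1)]) \<in> sb_rel n"
| sig_sig: "\<lbrakk>i \<in> {1..<n}; j \<in> {1..<n}; \<bar>int i - int j\<bar> \<ge> 2\<rbrakk> \<Longrightarrow>
    ([Sig i, Sig j], [Sig j, Sig i]) \<in> sb_rel n"
| tau_tau: "\<lbrakk>i \<in> {1..<n}; j \<in> {1..<n}; \<bar>int i - int j\<bar> \<ge> 2\<rbrakk> \<Longrightarrow>
    ([Tau i, Tau j], [Tau j, Tau i]) \<in> sb_rel n"
| tau_sig: "\<lbrakk>i \<in> {1..<n}; j \<in> {1..<n}; \<bar>int i - int j\<bar> \<ge> 2\<rbrakk> \<Longrightarrow>
    ([Tau i, Sig j], [Sig j, Tau i]) \<in> sb_rel n"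
| tau_sig_same: "i \<in> {1..<n} \<Longrightarrow> ([Tau i, Sig i], [Sig i, Tau i]) \<in> sb_rel n"
| sig_sig_tau: "\<lbrakk>1 \<le> i; i + 2 \<le> n\<rbrakk> \<Longrightarrow>
    ([Sig i, Sig (i + 1), Tau i], [Tau (i + 1), Sig i, Sig (i + 1)]) \<in> sb_rel n"
| sig_sig_tau': "\<lbrakk>1 \<le> i; i + 2 \<le> n\<rbrakk> \<Longrightarrow>
    ([Sig (i + 1), Sig i, Tau (i + 1)], [Tau i, Sig (i + 1), Sig i]) \<in> sb_rel n"

inductive_set sb_cong :: "nat \<Rightarrow> (sb_letter list \<times> sb_letter list) set" for n where
  rel: "\<lbrakk>(u, v) \<in> sb_rel n; w \<in> sb_words n; w' \<in> sb_words n\<rbrakk> \<Longrightarrow>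
    (w @ u @ w', w @ v @ w') \<in> sb_cong n"
| refl: "u \<in> sb_words n \<Longrightarrow> (u, u) \<in> sb_cong n"
| sym: "(u, v) \<in> sb_cong n \<Longrightarrow> (v, u) \<in> sb_cong n"
| trans: "\<lbrakk>(u, v) \<in> sb_cong n; (v, w) \<in> sb_cong n\<rbrakk> \<Longrightarrow> (u, w) \<in> sb_cong n"

definition sb_class :: "nat \<Rightarrow> sb_letter list \<Rightarrow> sb_letter list set" where
  "sb_class n w = sb_cong n `` {w}"

definition SB :: "nat \<Rightarrow> sb_letter list set monoid" where
  "SB n = \<lparr>carrier = sb_words n // sb_cong n,
           monoid.mult = (\<lambda>A B. \<Union>u\<in>A. \<Union>v\<in>B. sb_class n (u @ v)),
           one = sb_class n []\<rparr>"

lemma sb_words_simps [simp]: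
  "[] \<in> sb_words n"
  "l # w \<in> sb_words n \<longleftrightarrow> sb_index l \<in> {1..<n} \<and> w \<in> sb_words n"
  "u @ v \<in> sb_words n \<longleftrightarrow> u \<in> sb_words n \<and> v \<in> sb_words n"
  by (auto simp: sb_words_def)

lemma sb_rel_words: "(u, v) \<in> sb_rel n \<Longrightarrow> u \<in> sb_words n \<and> v \<in> sb_words n"
  by (induction rule: sb_rel.induct) auto

lemma sb_cong_words: "(u, v) \<in> sb_cong n \<Longrightarrow> u \<in> sb_words n \<and> v \<in> sb_words n"
  by (induction rule: sb_cong.induct) (auto dest: sb_rel_words)

lemma equiv_sb_cong: "equiv (sb_words n) (sb_cong n)"
proof (rule equivI)
  show "sb_cong n \<subseteq> sb_words n \<times> sb_words n"
    by (auto dest: sb_cong_words)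
  show "refl_on (sb_words n) (sb_cong n)"
    by (auto simp: refl_on_def sb_cong.refl)
  show "Relation.sym (sb_cong n)"
    by (auto intro!: symI sb_cong.sym)
  show "Relation.trans (sb_cong n)"
    by (auto intro!: transI intro: sb_cong.trans)
qed

lemma sb_cong_context:
  "\<lbrakk>(u, v) \<in> sb_cong n; w \<in> sb_words n; w' \<in> sb_words n\<rbrakk> \<Longrightarrow>
    (w @ u @ w', w @ v @ w') \<in> sb_cong n"
proof (induction rule: sb_cong.induct)
  case (rel u v x x')
  then show ?case
    using sb_cong.rel[of u v n "w @ x" "x' @ w'"] by simp
qed (auto intro: sb_cong.refl sb_cong.sym sb_cong.trans)

lemma sb_cong_append:
  assumes "(u, u') \<in> sb_cong n" "(v, v') \<in> sb_cong n"
  shows "(u @ v, u' @ v') \<in> sb_cong n"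
proof -
  have "(u @ v, u' @ v) \<in> sb_cong n"
    using sb_cong_context[OF assms(1), of "[]" v] sb_cong_words[OF assms(2)] by simp
  moreover have "(u' @ v, u' @ v') \<in> sb_cong n"
    using sb_cong_context[OF assms(2), of u' "[]"] sb_cong_words[OF assms(1)] by simp
  ultimately show ?thesis by (rule sb_cong.trans)
qed

lemma sb_class_eq_iff:
  "\<lbrakk>u \<in> sb_words n; v \<in> sb_words n\<rbrakk> \<Longrightarrow> sb_class n u = sb_class n v \<longleftrightarrow> (u, v) \<in> sb_cong n"
  unfolding sb_class_def by (rule eq_equiv_class_iff[OF equiv_sb_cong])

lemma SB_carrier_iff: "A \<in> carrier (SB n) \<longleftrightarrow> (\<exists>w\<in>sb_words n. A = sb_class n w)"
  by (auto simp: SB_def sb_class_def quotient_def)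

lemma SB_mult_class:
  assumes "u \<in> sb_words n" "v \<in> sb_words n"
  shows "sb_class n u \<otimes>\<^bsub>SB n\<^esub> sb_class n v = sb_class n (u @ v)"
proof -
  have "sb_class n (u' @ v') = sb_class n (u @ v)"
    if "u' \<in> sb_class n u" "v' \<in> sb_class n v" for u' v'
    using that sb_cong_append[of u u' n v v'] sb_cong_words[of "u @ v" "u' @ v'" n]
    by (simp add: sb_class_def[of n u] sb_class_def[of n v] sb_class_eq_iff sb_cong.sym)
  moreover have "u \<in> sb_class n u" "v \<in> sb_class n v"
    using assms by (auto simp: sb_class_def intro: sb_cong.refl)
  ultimately have "(\<Union>a\<in>sb_class n u. \<Union>b\<in>sb_class n v. sb_class n (a @ b)) = sb_class n (u @ v)"
    by blast
  then show ?thesis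
    by (simp add: SB_def)
qed

lemma SB_one: "\<one>\<^bsub>SB n\<^esub> = sb_class n []"
  by (simp add: SB_def)

lemma monoid_SB: "monoid (SB n)"
proof (rule monoidI)
  show "x \<otimes>\<^bsub>SB n\<^esub> y \<in> carrier (SB n)" if "x \<in> carrier (SB n)" "y \<in> carrier (SB n)" for x y
    using that unfolding SB_carrier_iff by (metis SB_mult_class sb_words_simps(3))
qed (auto simp: SB_carrier_iff SB_mult_class SB_one intro: bexI[of _ "[]"])


section \<open>Quandles and oriented singquandles\<close>

record 'a quandle_struct = "'a partial_object" +
  star :: "'a \<Rightarrow> 'a \<Rightarrow> 'a" (infixl "\<star>\<index>" 70)

definition bar_star :: "('a, 'b) quandle_struct_scheme \<Rightarrow> 'a \<Rightarrow> 'a \<Rightarrow> 'a"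
    (infixl "\<star>\<^sup>-\<index>" 70) where
  "x \<star>\<^sup>-\<^bsub>Q\<^esub> y = (THE z. z \<in> carrier Q \<and> x = z \<star>\<^bsub>Q\<^esub> y)"

locale quandle =
  fixes Q (structure)
  assumes nonempty: "carrier Q \<noteq> {}"
    and star_closed [simp, intro]: "\<lbrakk>x \<in> carrier Q; y \<in> carrier Q\<rbrakk> \<Longrightarrow> x \<star> y \<in> carrier Q"
    and idem: "x \<in> carrier Q \<Longrightarrow> x \<star> x = x"
    and right_div: "\<lbrakk>x \<in> carrier Q; y \<in> carrier Q\<rbrakk> \<Longrightarrow> \<exists>!z. z \<in> carrier Q \<and> x = z \<star> y"
    and distrib: "\<lbrakk>x \<in> carrier Q; y \<in> carrier Q; z \<in> carrier Q\<rbrakk> \<Longrightarrow>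
      (x \<star> y) \<star> z = (x \<star> z) \<star> (y \<star> z)"

record 'a singquandle_struct = "'a quandle_struct" +
  circ_l :: "'a \<Rightarrow> 'a \<Rightarrow> 'a" (infixl "\<circ>\<^sub>l\<index>" 70)
  circ_r :: "'a \<Rightarrow> 'a \<Rightarrow> 'a" (infixl "\<circ>\<^sub>r\<index>" 70)

locale oriented_singquandle = quandle X for X (structure) +
  assumes circ_l_closed [simp, intro]:
      "\<lbrakk>x \<in> carrier X; y \<in> carrier X\<rbrakk> \<Longrightarrow> x \<circ>\<^sub>l y \<in> carrier X"
    and circ_r_closed [simp, intro]:
      "\<lbrakk>x \<in> carrier X; y \<in> carrier X\<rbrakk> \<Longrightarrow> x \<circ>\<^sub>r y \<in> carrier X"
    and circ_l_star: "\<lbrakk>x \<in> carrier X; y \<in> carrier X; z \<in> carrier X\<rbrakk> \<Longrightarrow>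
      (x \<circ>\<^sub>l y) \<star> z = (x \<star> z) \<circ>\<^sub>l (y \<star> z)"
    and circ_r_star: "\<lbrakk>x \<in> carrier X; y \<in> carrier X; z \<in> carrier X\<rbrakk> \<Longrightarrow>
      (x \<circ>\<^sub>r y) \<star> z = (x \<star> z) \<circ>\<^sub>r (y \<star> z)"
    and circ_l_bar: "\<lbrakk>x \<in> carrier X; y \<in> carrier X; z \<in> carrier X\<rbrakk> \<Longrightarrow>
      (x \<circ>\<^sub>l y) \<star>\<^sup>- z = (x \<star>\<^sup>- z) \<circ>\<^sub>l (y \<star>\<^sup>- z)"
    and circ_r_bar: "\<lbrakk>x \<in> carrier X; y \<in> carrier X; z \<in> carrier X\<rbrakk> \<Longrightarrow>
      (x \<circ>\<^sub>r y) \<star>\<^sup>- z = (x \<star>\<^sup>- z) \<circ>\<^sub>r (y \<star>\<^sup>- z)"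
    and bar_circ: "\<lbrakk>x \<in> carrier X; y \<in> carrier X; z \<in> carrier X\<rbrakk> \<Longrightarrow>
      (y \<star>\<^sup>- (x \<circ>\<^sub>l z)) \<star> x = (y \<star> (x \<circ>\<^sub>r z)) \<star>\<^sup>- z"
    and circ_r_eq: "\<lbrakk>x \<in> carrier X; y \<in> carrier X\<rbrakk> \<Longrightarrow> x \<circ>\<^sub>r y = y \<circ>\<^sub>l (x \<star> y)"
    and circ_star_circ: "\<lbrakk>x \<in> carrier X; y \<in> carrier X\<rbrakk> \<Longrightarrow>
      (x \<circ>\<^sub>l y) \<star> (x \<circ>\<^sub>r y) = y \<circ>\<^sub>r (x \<star> y)"

context quandle begin

lemma
  assumes "x \<in> carrier Q" "y \<in> carrier Q"
  shows bar_closed [simp, intro]: "x \<star>\<^sup>- y \<in> carrier Q"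
    and bar_then_star [simp]: "(x \<star>\<^sup>- y) \<star> y = x"
  using theI'[OF right_div[OF assms]] by (auto simp: bar_star_def)

lemma bar_eqI:
  assumes "x \<in> carrier Q" "y \<in> carrier Q" "z \<in> carrier Q" "x = z \<star> y"
  shows "x \<star>\<^sup>- y = z"
  using right_div[OF assms(1,2)] assms bar_then_star[OF assms(1,2)] bar_closed[OF assms(1,2)]
  by metis

lemma star_then_bar [simp]:
  "\<lbrakk>x \<in> carrier Q; y \<in> carrier Q\<rbrakk> \<Longrightarrow> (x \<star> y) \<star>\<^sup>- y = x"
  by (rule bar_eqI) auto

end

definition sq_hom :: "('a, 'c) singquandle_struct_scheme \<Rightarrow> ('b, 'd) singquandle_struct_scheme
    \<Rightarrow> ('a \<Rightarrow> 'b) set" where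
  "sq_hom X Y = {f \<in> carrier X \<rightarrow> carrier Y. \<forall>x\<in>carrier X. \<forall>y\<in>carrier X.
     f (x \<star>\<^bsub>X\<^esub> y) = f x \<star>\<^bsub>Y\<^esub> f y \<and>
     f (x \<star>\<^sup>-\<^bsub>X\<^esub> y) = f x \<star>\<^sup>-\<^bsub>Y\<^esub> f y \<and>
     f (x \<circ>\<^sub>l\<^bsub>X\<^esub> y) = f x \<circ>\<^sub>l\<^bsub>Y\<^esub> f y \<and>
     f (x \<circ>\<^sub>r\<^bsub>X\<^esub> y) = f x \<circ>\<^sub>r\<^bsub>Y\<^esub> f y}"

text \<open>The product of two endomorphisms is \<open>f \<otimes> g = f \<circ> g\<close>. Reversing words maps the defining
  relations of the singular braid monoid to themselves (up to swapping the two sides), so images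
  of its generators extend to a homomorphism into this monoid if and only if they extend to one
  into its opposite.\<close>

definition sq_End :: "('a, 'c) singquandle_struct_scheme \<Rightarrow> ('a \<Rightarrow> 'a) monoid" where
  "sq_End X = \<lparr>carrier = sq_hom X X \<inter> extensional (carrier X),
               monoid.mult = (\<lambda>f g. compose (carrier X) f g),
               one = (\<lambda>x\<in>carrier X. x)\<rparr>"

lemma (in oriented_singquandle) monoid_sq_End: "monoid (sq_End X)"
proof (rule monoidI)
  fix f g h
  show "f \<otimes>\<^bsub>sq_End X\<^esub> g \<in> carrier (sq_End X)"
    if "f \<in> carrier (sq_End X)" "g \<in> carrier (sq_End X)"
    using that by (auto simp: sq_End_def sq_hom_def compose_def Pi_def)
  show "(f \<otimes>\<^bsub>sq_End X\<^esub> g) \<otimes>\<^bsub>sq_End X\<^esub> h = f \<otimes>\<^bsub>sq_End X\<^esub> (g \<otimes>\<^bsub>sq_End X\<^esub> h)"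
    if "f \<in> carrier (sq_End X)" "g \<in> carrier (sq_End X)" "h \<in> carrier (sq_End X)"
    using that by (auto simp: sq_End_def sq_hom_def compose_def Pi_def restrict_def)
qed (auto simp: sq_End_def sq_hom_def Pi_def Id_compose compose_Id)


section \<open>The free oriented singquandle\<close>

datatype sq_term = Gen nat
  | Star sq_term sq_term | Bar sq_term sq_term | CircL sq_term sq_term | CircR sq_term sq_term

primrec sq_gens :: "sq_term \<Rightarrow> nat set" where
  "sq_gens (Gen i) = {i}"
| "sq_gens (Star s t) = sq_gens s \<union> sq_gens t"
| "sq_gens (Bar s t) = sq_gens s \<union> sq_gens t"
| "sq_gens (CircL s t) = sq_gens s \<union> sq_gens t"
| "sq_gens (CircR s t) = sq_gens s \<union> sq_gens t"

definition sq_terms :: "nat \<Rightarrow> sq_term set" where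
  "sq_terms n = {t. sq_gens t \<subseteq> {1..n}}"

text \<open>The existence of a unique right quotient is expressed equationally by
  \<open>star_bar\<close> and \<open>bar_star\<close>.\<close>

inductive_set sq_cong :: "nat \<Rightarrow> (sq_term \<times> sq_term) set" for n where
  idem: "a \<in> sq_terms n \<Longrightarrow> (Star a a, a) \<in> sq_cong n"
| star_bar: "\<lbrakk>a \<in> sq_terms n; b \<in> sq_terms n\<rbrakk> \<Longrightarrow> (Bar (Star a b) b, a) \<in> sq_cong n"
| bar_star: "\<lbrakk>a \<in> sq_terms n; b \<in> sq_terms n\<rbrakk> \<Longrightarrow> (Star (Bar a b) b, a) \<in> sq_cong n"
| distrib: "\<lbrakk>a \<in> sq_terms n; b \<in> sq_terms n; c \<in> sq_terms n\<rbrakk> \<Longrightarrow>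
    (Star (Star a b) c, Star (Star a c) (Star b c)) \<in> sq_cong n"
| circ_l_star: "\<lbrakk>a \<in> sq_terms n; b \<in> sq_terms n; c \<in> sq_terms n\<rbrakk> \<Longrightarrow>
    (Star (CircL a b) c, CircL (Star a c) (Star b c)) \<in> sq_cong n"
| circ_r_star: "\<lbrakk>a \<in> sq_terms n; b \<in> sq_terms n; c \<in> sq_terms n\<rbrakk> \<Longrightarrow>
    (Star (CircR a b) c, CircR (Star a c) (Star b c)) \<in> sq_cong n"
| circ_l_bar: "\<lbrakk>a \<in> sq_terms n; b \<in> sq_terms n; c \<in> sq_terms n\<rbrakk> \<Longrightarrow>
    (Bar (CircL a b) c, CircL (Bar a c) (Bar b c)) \<in> sq_cong n"
| circ_r_bar: "\<lbrakk>a \<in> sq_terms n; b \<in> sq_terms n; c \<in> sq_terms n\<rbrakk> \<Longrightarrow>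
    (Bar (CircR a b) c, CircR (Bar a c) (Bar b c)) \<in> sq_cong n"
| bar_circ: "\<lbrakk>a \<in> sq_terms n; b \<in> sq_terms n; c \<in> sq_terms n\<rbrakk> \<Longrightarrow>
    (Star (Bar b (CircL a c)) a, Bar (Star b (CircR a c)) c) \<in> sq_cong n"
| circ_r_eq: "\<lbrakk>a \<in> sq_terms n; b \<in> sq_terms n\<rbrakk> \<Longrightarrow>
    (CircR a b, CircL b (Star a b)) \<in> sq_cong n"
| circ_star_circ: "\<lbrakk>a \<in> sq_terms n; b \<in> sq_terms n\<rbrakk> \<Longrightarrow>
    (Star (CircL a b) (CircR a b), CircR b (Star a b)) \<in> sq_cong n"
| refl: "a \<in> sq_terms n \<Longrightarrow> (a, a) \<in> sq_cong n"
| sym: "(a, b) \<in> sq_cong n \<Longrightarrow> (b, a) \<in> sq_cong n"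
| trans: "\<lbrakk>(a, b) \<in> sq_cong n; (b, c) \<in> sq_cong n\<rbrakk> \<Longrightarrow> (a, c) \<in> sq_cong n"
| cong_Star: "\<lbrakk>(a, a') \<in> sq_cong n; (b, b') \<in> sq_cong n\<rbrakk> \<Longrightarrow> (Star a b, Star a' b') \<in> sq_cong n"
| cong_Bar: "\<lbrakk>(a, a') \<in> sq_cong n; (b, b') \<in> sq_cong n\<rbrakk> \<Longrightarrow> (Bar a b, Bar a' b') \<in> sq_cong n"
| cong_CircL: "\<lbrakk>(a, a') \<in> sq_cong n; (b, b') \<in> sq_cong n\<rbrakk> \<Longrightarrow> (CircL a b, CircL a' b') \<in> sq_cong n"
| cong_CircR: "\<lbrakk>(a, a') \<in> sq_cong n; (b, b') \<in> sq_cong n\<rbrakk> \<Longrightarrow> (CircR a b, CircR a' b') \<in> sq_cong n"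

definition sq_class :: "nat \<Rightarrow> sq_term \<Rightarrow> sq_term set" where
  "sq_class n t = sq_cong n `` {t}"

definition FSQ :: "nat \<Rightarrow> sq_term set singquandle_struct" where
  "FSQ n = \<lparr>carrier = sq_terms n // sq_cong n,
            star = (\<lambda>A B. \<Union>a\<in>A. \<Union>b\<in>B. sq_class n (Star a b)),
            circ_l = (\<lambda>A B. \<Union>a\<in>A. \<Union>b\<in>B. sq_class n (CircL a b)),
            circ_r = (\<lambda>A B. \<Union>a\<in>A. \<Union>b\<in>B. sq_class n (CircR a b))\<rparr>"

definition fsq_gen :: "nat \<Rightarrow> nat \<Rightarrow> sq_term set" where
  "fsq_gen n i = sq_class n (Gen i)"

lemma sq_terms_simps [simp]:
  "Gen i \<in> sq_terms n \<longleftrightarrow> i \<in> {1..n}"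
  "Star s t \<in> sq_terms n \<longleftrightarrow> s \<in> sq_terms n \<and> t \<in> sq_terms n"
  "Bar s t \<in> sq_terms n \<longleftrightarrow> s \<in> sq_terms n \<and> t \<in> sq_terms n"
  "CircL s t \<in> sq_terms n \<longleftrightarrow> s \<in> sq_terms n \<and> t \<in> sq_terms n"
  "CircR s t \<in> sq_terms n \<longleftrightarrow> s \<in> sq_terms n \<and> t \<in> sq_terms n"
  by (auto simp: sq_terms_def)

lemma sq_cong_terms: "(s, t) \<in> sq_cong n \<Longrightarrow> s \<in> sq_terms n \<and> t \<in> sq_terms n"
  by (induction rule: sq_cong.induct) auto

lemma equiv_sq_cong: "equiv (sq_terms n) (sq_cong n)"
proof (rule equivI)
  show "sq_cong n \<subseteq> sq_terms n \<times> sq_terms n"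
    by (auto dest: sq_cong_terms)
  show "refl_on (sq_terms n) (sq_cong n)"
    by (auto simp: refl_on_def sq_cong.refl)
  show "Relation.sym (sq_cong n)"
    by (auto intro!: symI sq_cong.sym)
  show "Relation.trans (sq_cong n)"
    by (auto intro!: transI intro: sq_cong.trans)
qed

lemma sq_class_eq_iff:
  "\<lbrakk>s \<in> sq_terms n; t \<in> sq_terms n\<rbrakk> \<Longrightarrow> sq_class n s = sq_class n t \<longleftrightarrow> (s, t) \<in> sq_cong n"
  unfolding sq_class_def by (rule eq_equiv_class_iff[OF equiv_sq_cong])

lemma sq_class_eqI: "(s, t) \<in> sq_cong n \<Longrightarrow> sq_class n s = sq_class n t"
  using sq_class_eq_iff sq_cong_terms by blast

lemma FSQ_carrier_iff: "A \<in> carrier (FSQ n) \<longleftrightarrow> (\<exists>t\<in>sq_terms n. A = sq_class n t)"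
  by (auto simp: FSQ_def sq_class_def quotient_def)

lemma FSQ_carrierE:
  assumes "A \<in> carrier (FSQ n)"
  obtains t where "t \<in> sq_terms n" "A = sq_class n t"
  using assms by (auto simp: FSQ_carrier_iff)

lemma sq_class_closed [simp]: "t \<in> sq_terms n \<Longrightarrow> sq_class n t \<in> carrier (FSQ n)"
  by (auto simp: FSQ_carrier_iff)

lemma sq_class_UN:
  assumes "\<And>a a' b b'. \<lbrakk>(a, a') \<in> sq_cong n; (b, b') \<in> sq_cong n\<rbrakk> \<Longrightarrow> (F a b, F a' b') \<in> sq_cong n"
    and "s \<in> sq_terms n" "t \<in> sq_terms n"
  shows "(\<Union>a\<in>sq_class n s. \<Union>b\<in>sq_class n t. sq_class n (F a b)) = sq_class n (F s t)"
proof -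
  have "sq_class n (F a b) = sq_class n (F s t)"
    if "a \<in> sq_class n s" "b \<in> sq_class n t" for a b
    using that assms(1) by (metis Image_singleton_iff sq_class_def sq_class_eqI)
  moreover have "s \<in> sq_class n s" "t \<in> sq_class n t"
    using assms(2,3) by (auto simp: sq_class_def intro: sq_cong.refl)
  ultimately show ?thesis by blast
qed

lemma FSQ_star_class:
  "\<lbrakk>s \<in> sq_terms n; t \<in> sq_terms n\<rbrakk> \<Longrightarrow>
    sq_class n s \<star>\<^bsub>FSQ n\<^esub> sq_class n t = sq_class n (Star s t)"
  by (simp add: FSQ_def sq_class_UN sq_cong.cong_Star)

lemma FSQ_circ_l_class:
  "\<lbrakk>s \<in> sq_terms n; t \<in> sq_terms n\<rbrakk> \<Longrightarrow>
    sq_class n s \<circ>\<^sub>l\<^bsub>FSQ n\<^esub> sq_class n t = sq_class n (CircL s t)"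
  by (simp add: FSQ_def sq_class_UN sq_cong.cong_CircL)

lemma FSQ_circ_r_class:
  "\<lbrakk>s \<in> sq_terms n; t \<in> sq_terms n\<rbrakk> \<Longrightarrow>
    sq_class n s \<circ>\<^sub>r\<^bsub>FSQ n\<^esub> sq_class n t = sq_class n (CircR s t)"
  by (simp add: FSQ_def sq_class_UN sq_cong.cong_CircR)

lemma FSQ_right_div:
  assumes "s \<in> sq_terms n" "t \<in> sq_terms n"
  shows "z \<in> carrier (FSQ n) \<and> sq_class n s = z \<star>\<^bsub>FSQ n\<^esub> sq_class n t \<longleftrightarrow> z = sq_class n (Bar s t)"
    (is "?L \<longleftrightarrow> ?R")
proof
  assume ?L
  then obtain r where r: "r \<in> sq_terms n" "z = sq_class n r"
    by (auto simp: FSQ_carrier_iff)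
  have "(s, Star r t) \<in> sq_cong n"
    using \<open>?L\<close> r assms by (simp add: FSQ_star_class sq_class_eq_iff)
  then have "(Bar s t, Bar (Star r t) t) \<in> sq_cong n"
    using assms by (intro sq_cong.cong_Bar sq_cong.refl)
  then have "(Bar s t, r) \<in> sq_cong n"
    using sq_cong.star_bar[OF r(1) assms(2)] by (rule sq_cong.trans)
  then show ?R
    using r sq_class_eqI by simp
next
  assume ?R
  then show ?L
    using assms sq_class_eqI[OF sq_cong.bar_star[OF assms]] by (simp add: FSQ_star_class)
qed

lemma FSQ_bar_class:
  "\<lbrakk>s \<in> sq_terms n; t \<in> sq_terms n\<rbrakk> \<Longrightarrow>
    sq_class n s \<star>\<^sup>-\<^bsub>FSQ n\<^esub> sq_class n t = sq_class n (Bar s t)"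
  by (simp add: bar_star_def FSQ_right_div)

lemmas FSQ_class_simps = FSQ_star_class FSQ_bar_class FSQ_circ_l_class FSQ_circ_r_class

lemma oriented_singquandle_FSQ:
  assumes "n \<ge> 1"
  shows "oriented_singquandle (FSQ n)"
proof unfold_locales
  show "carrier (FSQ n) \<noteq> {}"
    using sq_class_closed[of "Gen 1" n] assms
    by (metis atLeastAtMost_iff empty_iff order_refl sq_terms_simps(1))
  show "\<exists>!z. z \<in> carrier (FSQ n) \<and> x = z \<star>\<^bsub>FSQ n\<^esub> y"
    if xy: "x \<in> carrier (FSQ n)" "y \<in> carrier (FSQ n)" for x y
  proof -
    obtain s t where "s \<in> sq_terms n" "t \<in> sq_terms n" "x = sq_class n s" "y = sq_class n t"
      using xy unfolding FSQ_carrier_iff by blast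
    then show ?thesis
      by (simp only: FSQ_right_div) simp
  qed
qed (elim FSQ_carrierE; simp add: FSQ_class_simps sq_class_eq_iff sq_cong.idem sq_cong.distrib
      sq_cong.circ_l_star sq_cong.circ_r_star sq_cong.circ_l_bar sq_cong.circ_r_bar
      sq_cong.bar_circ sq_cong.circ_r_eq sq_cong.circ_star_circ)+

primrec sq_eval :: "('a, 'c) singquandle_struct_scheme \<Rightarrow> (nat \<Rightarrow> 'a) \<Rightarrow> sq_term \<Rightarrow> 'a" where
  "sq_eval Y f (Gen i) = f i"
| "sq_eval Y f (Star s t) = sq_eval Y f s \<star>\<^bsub>Y\<^esub> sq_eval Y f t"
| "sq_eval Y f (Bar s t) = sq_eval Y f s \<star>\<^sup>-\<^bsub>Y\<^esub> sq_eval Y f t"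
| "sq_eval Y f (CircL s t) = sq_eval Y f s \<circ>\<^sub>l\<^bsub>Y\<^esub> sq_eval Y f t"
| "sq_eval Y f (CircR s t) = sq_eval Y f s \<circ>\<^sub>r\<^bsub>Y\<^esub> sq_eval Y f t"

context oriented_singquandle begin

lemma sq_eval_closed:
  "\<lbrakk>f \<in> {1..n} \<rightarrow> carrier X; t \<in> sq_terms n\<rbrakk> \<Longrightarrow> sq_eval X f t \<in> carrier X"
  by (induction t) auto

lemma sq_eval_cong:
  assumes f: "f \<in> {1..n} \<rightarrow> carrier X" and "(s, t) \<in> sq_cong n"
  shows "sq_eval X f s = sq_eval X f t"
  using assms(2)
  by (induction rule: sq_cong.induct)
    (auto simp: sq_eval_closed[OF f] intro: idem distrib circ_l_star circ_r_star
      circ_l_bar circ_r_bar bar_circ circ_r_eq circ_star_circ)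

text \<open>The universal property of \<^term>\<open>FSQ n\<close>.\<close>

theorem FSQ_universal:
  assumes f: "f \<in> {1..n} \<rightarrow> carrier X"
  shows "\<exists>!h. h \<in> sq_hom (FSQ n) X \<inter> extensional (carrier (FSQ n)) \<and>
               (\<forall>i\<in>{1..n}. h (fsq_gen n i) = f i)"
proof (rule ex_ex1I)
  define h where "h = (\<lambda>A\<in>carrier (FSQ n). sq_eval X f (SOME t. t \<in> A))"
  have h: "h (sq_class n t) = sq_eval X f t" if t: "t \<in> sq_terms n" for t
  proof -
    have "t \<in> sq_class n t"
      using t by (auto simp: sq_class_def intro: sq_cong.refl)
    then have "(SOME u. u \<in> sq_class n t) \<in> sq_class n t"
      by (rule someI)
    then have "(t, SOME u. u \<in> sq_class n t) \<in> sq_cong n"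
      by (simp add: sq_class_def)
    then show ?thesis
      using sq_eval_cong[OF f] t by (simp add: h_def)
  qed
  have "h \<in> sq_hom (FSQ n) X"
    unfolding sq_hom_def
    by (auto simp: FSQ_carrier_iff FSQ_class_simps h sq_eval_closed[OF f])
  moreover have "h \<in> extensional (carrier (FSQ n))"
    by (simp add: h_def)
  moreover have "\<forall>i\<in>{1..n}. h (fsq_gen n i) = f i"
    by (simp add: fsq_gen_def h)
  ultimately show "\<exists>h. h \<in> sq_hom (FSQ n) X \<inter> extensional (carrier (FSQ n)) \<and>
      (\<forall>i\<in>{1..n}. h (fsq_gen n i) = f i)" by blast
next
  have ev: "h (sq_class n t) = sq_eval X f t"
    if h: "h \<in> sq_hom (FSQ n) X" "\<forall>i\<in>{1..n}. h (fsq_gen n i) = f i" and t: "t \<in> sq_terms n" for h t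
    using t
  proof (induction t)
    case (Gen i)
    then show ?case using h(2) by (simp add: fsq_gen_def)
  qed (use h(1) in \<open>simp_all add: sq_hom_def flip: FSQ_class_simps\<close>)
  show "h = h'"
    if "h \<in> sq_hom (FSQ n) X \<inter> extensional (carrier (FSQ n)) \<and> (\<forall>i\<in>{1..n}. h (fsq_gen n i) = f i)"
      "h' \<in> sq_hom (FSQ n) X \<inter> extensional (carrier (FSQ n)) \<and> (\<forall>i\<in>{1..n}. h' (fsq_gen n i) = f i)"
    for h h'
    by (rule extensionalityI[of _ "carrier (FSQ n)"])
      (use that in \<open>auto elim!: FSQ_carrierE simp: ev\<close>)
qed

end

end

theory Submission
  imports Defs
begin

text \<open>By the universal property of the free oriented singquandle, endomorphisms are determined
  by their values on the generators, so each defining relation of the singular braid monoid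
  reduces to an identity in three elements: the braid relation is the right distributive law,
  \<open>\<tau>\<^sub>i \<sigma>\<^sub>i = \<sigma>\<^sub>i \<tau>\<^sub>i\<close> is the pair of axioms \<open>x \<circ>\<^sub>r y = y \<circ>\<^sub>l (x \<star> y)\<close> and
  \<open>(x \<circ>\<^sub>l y) \<star> (x \<circ>\<^sub>r y) = y \<circ>\<^sub>r (x \<star> y)\<close>, the relation \<open>\<sigma>\<^sub>i \<sigma>\<^sub>i\<^sub>+\<^sub>1 \<tau>\<^sub>i = \<tau>\<^sub>i\<^sub>+\<^sub>1 \<sigma>\<^sub>i \<sigma>\<^sub>i\<^sub>+\<^sub>1\<close> is
  \<open>(y \<star> (x \<circ>\<^sub>l z)) \<star> (x \<circ>\<^sub>r z) = (y \<star> x) \<star> z\<close>, and the last one is the compatibility of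
  \<open>\<circ>\<^sub>l\<close> and \<open>\<circ>\<^sub>r\<close> with \<open>\<star>\<close>.\<close>

section \<open>Evaluation of words in a monoid and homomorphisms out of \<open>SB n\<close>\<close>

definition word_prod :: "('a, 'b) monoid_scheme \<Rightarrow> (sb_letter \<Rightarrow> 'a) \<Rightarrow> sb_letter list \<Rightarrow> 'a" where
  "word_prod M f w = foldr (\<lambda>l g. f l \<otimes>\<^bsub>M\<^esub> g) w \<one>\<^bsub>M\<^esub>"

lemma word_prod_simps [simp]:
  "word_prod M f [] = \<one>\<^bsub>M\<^esub>"
  "word_prod M f (l # w) = f l \<otimes>\<^bsub>M\<^esub> word_prod M f w"
  by (simp_all add: word_prod_def)

context monoid begin

lemma word_prod_closed:
  assumes f: "f \<in> {l. sb_index l \<in> {1..<n}} \<rightarrow> carrier G" and "w \<in> sb_words n"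
  shows "word_prod G f w \<in> carrier G"
  using assms(2) by (induction w) (use f in auto)

lemma word_prod_append:
  assumes f: "f \<in> {l. sb_index l \<in> {1..<n}} \<rightarrow> carrier G"
    and "u \<in> sb_words n" "v \<in> sb_words n"
  shows "word_prod G f (u @ v) = word_prod G f u \<otimes> word_prod G f v"
  using assms(2,3)
  by (induction u) (use f in \<open>auto simp: Pi_iff m_assoc word_prod_closed[OF f]\<close>)

text \<open>Multiplicativity carries an identity between the two sides of a defining relation into
  every context \<open>w @ _ @ w'\<close>; the other closure rules are properties of
  equality.\<close>

lemma word_prod_cong:
  assumes f: "f \<in> {l. sb_index l \<in> {1..<n}} \<rightarrow> carrier G"
    and rel: "\<And>u v. (u, v) \<in> sb_rel n \<Longrightarrow> word_prod G f u = word_prod G f v"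
    and "(u, v) \<in> sb_cong n"
  shows "word_prod G f u = word_prod G f v"
  using assms(3)
proof (induction rule: sb_cong.induct)
  case (rel u v w w')
  then show ?case
    using sb_rel_words[OF rel(1)] assms(2)[OF rel(1)]
    by (simp add: word_prod_append[OF f])
qed auto

text \<open>The universal property of a presentation: letter images satisfying the defining
  relations extend to the presented monoid.\<close>

lemma SB_hom_exists:
  assumes f: "f \<in> {l. sb_index l \<in> {1..<n}} \<rightarrow> carrier G"
    and rel: "\<And>u v. (u, v) \<in> sb_rel n \<Longrightarrow> word_prod G f u = word_prod G f v"
  obtains \<Phi> where "\<Phi> \<in> extensional (carrier (SB n))" "\<Phi> \<in> hom (SB n) G"
    "\<And>w. w \<in> sb_words n \<Longrightarrow> \<Phi> (sb_class n w) = word_prod G f w"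
proof -
  \<comment> \<open>The value is read off an arbitrary representative; \<open>word_prod_cong\<close>
    makes the choice irrelevant.\<close>
  define \<Phi> where "\<Phi> = (\<lambda>A\<in>carrier (SB n). word_prod G f (SOME w. w \<in> A))"
  have \<Phi>: "\<Phi> (sb_class n w) = word_prod G f w" if w: "w \<in> sb_words n" for w
  proof -
    have "w \<in> sb_class n w"
      using w by (auto simp: sb_class_def intro: sb_cong.refl)
    then have "(SOME u. u \<in> sb_class n w) \<in> sb_class n w"
      by (rule someI)
    then have "(w, SOME u. u \<in> sb_class n w) \<in> sb_cong n"
      by (simp add: sb_class_def)
    moreover have "sb_class n w \<in> carrier (SB n)"
      using w by (auto simp: SB_carrier_iff)
    ultimately show ?thesis
      using word_prod_cong[OF f rel] by (simp add: \<Phi>_def)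
  qed
  have "\<Phi> \<in> hom (SB n) G"
    by (rule homI)
      (auto simp: SB_carrier_iff SB_mult_class \<Phi> word_prod_append[OF f]
        intro!: word_prod_closed[OF f])
  then show thesis
    using that[of \<Phi>] \<Phi> by (simp add: \<Phi>_def)
qed

end

text \<open>Each class is a product of classes of single letters. Since \<open>hom\<close> only
  demands multiplicativity, agreement on the unit is assumed separately; it starts the induction on
  words.\<close>

lemma SB_hom_eqI:
  assumes \<Phi>: "\<Phi> \<in> extensional (carrier (SB n))" "\<Phi> \<in> hom (SB n) M" "\<Phi> \<one>\<^bsub>SB n\<^esub> = \<one>\<^bsub>M\<^esub>"
    and \<Psi>: "\<Psi> \<in> extensional (carrier (SB n))" "\<Psi> \<in> hom (SB n) M" "\<Psi> \<one>\<^bsub>SB n\<^esub> = \<one>\<^bsub>M\<^esub>"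
    and eq: "\<And>l. sb_index l \<in> {1..<n} \<Longrightarrow> \<Phi> (sb_class n [l]) = \<Psi> (sb_class n [l])"
  shows "\<Phi> = \<Psi>"
proof (rule extensionalityI[OF \<Phi>(1) \<Psi>(1)])
  have "\<Phi> (sb_class n w) = \<Psi> (sb_class n w)" if "w \<in> sb_words n" for w
    using that
  proof (induction w)
    case Nil
    then show ?case using \<Phi>(3) \<Psi>(3) by (simp add: SB_one)
  next
    case (Cons l w)
    then have "sb_class n (l # w) = sb_class n [l] \<otimes>\<^bsub>SB n\<^esub> sb_class n w"
      by (simp add: SB_mult_class)
    moreover have "sb_class n [l] \<in> carrier (SB n)" "sb_class n w \<in> carrier (SB n)"
      using Cons.prems unfolding SB_carrier_iff
      by (metis sb_words_simps(1,2)) (use Cons.prems in auto)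
    ultimately show ?case
      using Cons eq hom_mult[OF \<Phi>(2)] hom_mult[OF \<Psi>(2)] by simp
  qed
  then show "\<Phi> A = \<Psi> A" if "A \<in> carrier (SB n)" for A
    using that by (auto simp: SB_carrier_iff)
qed

text \<open>This is \<open>bar_circ\<close> freed of right division: putting
  \<open>y \<star> (x \<circ>\<^sub>l z)\<close> for \<open>y\<close> cancels the inner division,
  and acting by \<open>z\<close> cancels the outer one.\<close>

lemma (in oriented_singquandle) star_circ_l_star_circ_r:
  assumes "x \<in> carrier X" "y \<in> carrier X" "z \<in> carrier X"
  shows "(y \<star> (x \<circ>\<^sub>l z)) \<star> (x \<circ>\<^sub>r z) = (y \<star> x) \<star> z"
proof -
  have "y \<star> x = ((y \<star> (x \<circ>\<^sub>l z)) \<star> (x \<circ>\<^sub>r z)) \<star>\<^sup>- z"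
    using bar_circ[of x "y \<star> (x \<circ>\<^sub>l z)" z] assms by simp
  then show ?thesis
    using assms by simp
qed

section \<open>Endomorphisms of \<open>FSQ n\<close> and the images of the generators\<close>

lemma fsq_gen_closed [simp]: "k \<in> {1..n} \<Longrightarrow> fsq_gen n k \<in> carrier (FSQ n)"
  by (simp add: fsq_gen_def)

lemma sq_hom_closed: "\<lbrakk>h \<in> sq_hom X Y; x \<in> carrier X\<rbrakk> \<Longrightarrow> h x \<in> carrier Y"
  by (auto simp: sq_hom_def)

lemma sq_homD:
  assumes "h \<in> sq_hom X Y" "x \<in> carrier X" "y \<in> carrier X"
  shows "h (x \<star>\<^bsub>X\<^esub> y) = h x \<star>\<^bsub>Y\<^esub> h y"
    "h (x \<star>\<^sup>-\<^bsub>X\<^esub> y) = h x \<star>\<^sup>-\<^bsub>Y\<^esub> h y"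
    "h (x \<circ>\<^sub>l\<^bsub>X\<^esub> y) = h x \<circ>\<^sub>l\<^bsub>Y\<^esub> h y"
    "h (x \<circ>\<^sub>r\<^bsub>X\<^esub> y) = h x \<circ>\<^sub>r\<^bsub>Y\<^esub> h y"
  using assms by (auto simp: sq_hom_def)

text \<open>The uniqueness half of \<open>FSQ_universal\<close>, applied to the values of
  \<open>h\<close> on the generators.\<close>

lemma FSQ_End_eqI:
  assumes g: "g \<in> carrier (sq_End (FSQ n))" and h: "h \<in> carrier (sq_End (FSQ n))"
    and eq: "\<And>k. k \<in> {1..n} \<Longrightarrow> g (fsq_gen n k) = h (fsq_gen n k)"
    and n: "n \<ge> 1"
  shows "g = h"
proof -
  interpret oriented_singquandle "FSQ n"
    by (rule oriented_singquandle_FSQ[OF n])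
  have "(\<lambda>k. h (fsq_gen n k)) \<in> {1..n} \<rightarrow> carrier (FSQ n)"
    using h by (auto simp: sq_End_def sq_hom_def)
  from FSQ_universal[OF this] show ?thesis
    using g h eq unfolding sq_End_def by auto
qed

text \<open>The inverse of the map for \<open>Sig i\<close> must send generator \<open>i + 1\<close>
  to generator \<open>i\<close>, and the product of generators \<open>i\<close> and
  \<open>i + 1\<close> to generator \<open>i + 1\<close>. Solving for the image of generator
  \<open>i\<close> gives the right quotient in the \<open>SigInv\<close> case.\<close>

definition letter_image :: "nat \<Rightarrow> sb_letter \<Rightarrow> nat \<Rightarrow> sq_term set" where
  "letter_image n l k = (case l of
     Sig i \<Rightarrow> if k = i then fsq_gen n (i + 1)
       else if k = i + 1 then fsq_gen n i \<star>\<^bsub>FSQ n\<^esub> fsq_gen n (i + 1) else fsq_gen n k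
   | SigInv i \<Rightarrow> if k = i then fsq_gen n (i + 1) \<star>\<^sup>-\<^bsub>FSQ n\<^esub> fsq_gen n i
       else if k = i + 1 then fsq_gen n i else fsq_gen n k
   | Tau i \<Rightarrow> if k = i then fsq_gen n i \<circ>\<^sub>l\<^bsub>FSQ n\<^esub> fsq_gen n (i + 1)
       else if k = i + 1 then fsq_gen n i \<circ>\<^sub>r\<^bsub>FSQ n\<^esub> fsq_gen n (i + 1) else fsq_gen n k)"

definition letter_endo :: "nat \<Rightarrow> sb_letter \<Rightarrow> sq_term set \<Rightarrow> sq_term set" where
  "letter_endo n l = (THE h. h \<in> sq_hom (FSQ n) (FSQ n) \<inter> extensional (carrier (FSQ n)) \<and>
     (\<forall>k\<in>{1..n}. h (fsq_gen n k) = letter_image n l k))"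

section \<open>The letter endomorphisms satisfy the defining relations\<close>

context
  fixes n :: nat
  assumes n: "n \<ge> 2"
begin

interpretation oriented_singquandle "FSQ n"
  using n by (intro oriented_singquandle_FSQ) simp

interpretation E: monoid "sq_End (FSQ n)"
  by (rule monoid_sq_End)

lemma letter_endo:
  assumes "sb_index l \<in> {1..<n}"
  shows letter_endo_closed: "letter_endo n l \<in> carrier (sq_End (FSQ n))"
    and letter_endo_gen: "k \<in> {1..n} \<Longrightarrow> letter_endo n l (fsq_gen n k) = letter_image n l k"
proof -
  \<comment> \<open>An index strictly below \<open>n\<close> keeps \<open>i + 1\<close> within
    \<open>{1..n}\<close>.\<close>
  have "letter_image n l \<in> {1..n} \<rightarrow> carrier (FSQ n)"
    using assms by (auto simp: letter_image_def split: sb_letter.splits)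
  from theI'[OF FSQ_universal[OF this]]
  show "letter_endo n l \<in> carrier (sq_End (FSQ n))"
    "k \<in> {1..n} \<Longrightarrow> letter_endo n l (fsq_gen n k) = letter_image n l k"
    by (auto simp: letter_endo_def sq_End_def)
qed

lemma letter_endo_Pi: "letter_endo n \<in> {l. sb_index l \<in> {1..<n}} \<rightarrow> carrier (sq_End (FSQ n))"
  using letter_endo_closed by auto

lemma letter_endo_hom: "sb_index l \<in> {1..<n} \<Longrightarrow> letter_endo n l \<in> sq_hom (FSQ n) (FSQ n)"
  using letter_endo_closed by (auto simp: sq_End_def)

lemmas letter_endo_apply = sq_hom_closed[OF letter_endo_hom] sq_homD[OF letter_endo_hom]

lemma letter_endo_Sig_gen:
  assumes "1 \<le> i" "i < n"
  shows "letter_endo n (Sig i) (fsq_gen n i) = fsq_gen n (Suc i)"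
    "letter_endo n (Sig i) (fsq_gen n (Suc i)) = fsq_gen n i \<star>\<^bsub>FSQ n\<^esub> fsq_gen n (Suc i)"
    "\<lbrakk>k \<noteq> i; k \<noteq> Suc i; 1 \<le> k; k \<le> n\<rbrakk> \<Longrightarrow> letter_endo n (Sig i) (fsq_gen n k) = fsq_gen n k"
  using assms by (simp_all add: letter_endo_gen letter_image_def)

lemma letter_endo_SigInv_gen:
  assumes "1 \<le> i" "i < n"
  shows "letter_endo n (SigInv i) (fsq_gen n i) = fsq_gen n (Suc i) \<star>\<^sup>-\<^bsub>FSQ n\<^esub> fsq_gen n i"
    "letter_endo n (SigInv i) (fsq_gen n (Suc i)) = fsq_gen n i"
    "\<lbrakk>k \<noteq> i; k \<noteq> Suc i; 1 \<le> k; k \<le> n\<rbrakk> \<Longrightarrow> letter_endo n (SigInv i) (fsq_gen n k) = fsq_gen n k"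
  using assms by (simp_all add: letter_endo_gen letter_image_def)

lemma letter_endo_Tau_gen:
  assumes "1 \<le> i" "i < n"
  shows "letter_endo n (Tau i) (fsq_gen n i) = fsq_gen n i \<circ>\<^sub>l\<^bsub>FSQ n\<^esub> fsq_gen n (Suc i)"
    "letter_endo n (Tau i) (fsq_gen n (Suc i)) = fsq_gen n i \<circ>\<^sub>r\<^bsub>FSQ n\<^esub> fsq_gen n (Suc i)"
    "\<lbrakk>k \<noteq> i; k \<noteq> Suc i; 1 \<le> k; k \<le> n\<rbrakk> \<Longrightarrow> letter_endo n (Tau i) (fsq_gen n k) = fsq_gen n k"
  using assms by (simp_all add: letter_endo_gen letter_image_def)

lemma sq_End_mult_apply:
  "x \<in> carrier (FSQ n) \<Longrightarrow> (g \<otimes>\<^bsub>sq_End (FSQ n)\<^esub> h) x = g (h x)"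
  by (simp add: sq_End_def compose_def)

lemma sq_End_one_apply: "x \<in> carrier (FSQ n) \<Longrightarrow> \<one>\<^bsub>sq_End (FSQ n)\<^esub> x = x"
  by (simp add: sq_End_def)

text \<open>Both sides are compared on each generator. The product is composition, so the last
  letter of a word acts first.\<close>

lemma letter_endo_rel:
  assumes "(u, v) \<in> sb_rel n"
  shows "word_prod (sq_End (FSQ n)) (letter_endo n) u = word_prod (sq_End (FSQ n)) (letter_endo n) v"
proof (rule FSQ_End_eqI)
  show "word_prod (sq_End (FSQ n)) (letter_endo n) u \<in> carrier (sq_End (FSQ n))"
    "word_prod (sq_End (FSQ n)) (letter_endo n) v \<in> carrier (sq_End (FSQ n))"
    using sb_rel_words[OF assms] by (auto intro!: E.word_prod_closed[OF letter_endo_Pi])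
  fix k assume k: "k \<in> {1..n}"
  then have k1: "1 \<le> k" "k \<le> n"
    by simp_all
  note simps = sq_End_mult_apply sq_End_one_apply letter_endo_apply
    letter_endo_Sig_gen letter_endo_SigInv_gen letter_endo_Tau_gen
  show "word_prod (sq_End (FSQ n)) (letter_endo n) u (fsq_gen n k) =
    word_prod (sq_End (FSQ n)) (letter_endo n) v (fsq_gen n k)"
    using assms
  proof cases
    case (sig_inv i)
    consider "k = i" | "k = Suc i" | "k \<noteq> i" "k \<noteq> Suc i"
      by blast
    then show ?thesis
      using sig_inv k1 by cases (simp_all add: simps)
  next
    case (inv_sig i)
    consider "k = i" | "k = Suc i" | "k \<noteq> i" "k \<noteq> Suc i"
      by blast
    then show ?thesis
      using inv_sig k1 by cases (simp_all add: simps)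
  next
    case (braid i)
    consider "k = i" | "k = Suc i" | "k = Suc (Suc i)" | "k \<noteq> i" "k \<noteq> Suc i" "k \<noteq> Suc (Suc i)"
      by blast
    \<comment> \<open>Distributivity enters at \<open>k = Suc (Suc i)\<close>. It is used from right
      to left, since its right-hand side is again an instance of its left-hand side.\<close>
    then show ?thesis
      using braid k1 by cases (simp_all add: simps flip: distrib)
  next
    case (sig_sig i j)
    \<comment> \<open>Distance at least 2 makes \<open>{i, i + 1}\<close> and
      \<open>{j, j + 1}\<close> disjoint, so each letter fixes the generators that the other one
      moves.\<close>
    then have "j \<noteq> i" "j \<noteq> Suc i" "i \<noteq> Suc j"
      by auto
    consider "k = i" | "k = Suc i" | "k = j" | "k = Suc j"
      | "k \<noteq> i" "k \<noteq> Suc i" "k \<noteq> j" "k \<noteq> Suc j"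
      by blast
    then show ?thesis
      using sig_sig k1 \<open>j \<noteq> i\<close> \<open>j \<noteq> Suc i\<close> \<open>i \<noteq> Suc j\<close> by cases (simp_all add: simps)
  next
    case (tau_tau i j)
    then have "j \<noteq> i" "j \<noteq> Suc i" "i \<noteq> Suc j"
      by auto
    consider "k = i" | "k = Suc i" | "k = j" | "k = Suc j"
      | "k \<noteq> i" "k \<noteq> Suc i" "k \<noteq> j" "k \<noteq> Suc j"
      by blast
    then show ?thesis
      using tau_tau k1 \<open>j \<noteq> i\<close> \<open>j \<noteq> Suc i\<close> \<open>i \<noteq> Suc j\<close> by cases (simp_all add: simps)
  next
    case (tau_sig i j)
    then have "j \<noteq> i" "j \<noteq> Suc i" "i \<noteq> Suc j"
      by auto
    consider "k = i" | "k = Suc i" | "k = j" | "k = Suc j"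
      | "k \<noteq> i" "k \<noteq> Suc i" "k \<noteq> j" "k \<noteq> Suc j"
      by blast
    then show ?thesis
      using tau_sig k1 \<open>j \<noteq> i\<close> \<open>j \<noteq> Suc i\<close> \<open>i \<noteq> Suc j\<close> by cases (simp_all add: simps)
  next
    case (tau_sig_same i)
    consider "k = i" | "k = Suc i" | "k \<noteq> i" "k \<noteq> Suc i"
      by blast
    \<comment> \<open>The case \<open>k = i\<close> is \<open>circ_r_eq\<close>, and
      \<open>k = Suc i\<close> is \<open>circ_star_circ\<close>.\<close>
    then show ?thesis
      using tau_sig_same k1 by cases (simp_all add: simps circ_star_circ flip: circ_r_eq)
  next
    case (sig_sig_tau i)
    consider "k = i" | "k = Suc i" | "k = Suc (Suc i)" | "k \<noteq> i" "k \<noteq> Suc i" "k \<noteq> Suc (Suc i)"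
      by blast
    \<comment> \<open>At \<open>k = Suc (Suc i)\<close> the identity applies with generators
      \<open>i\<close>, \<open>i + 1\<close>, \<open>i + 2\<close> as its \<open>y\<close>,
      \<open>x\<close>, \<open>z\<close>.\<close>
    then show ?thesis
      using sig_sig_tau k1 by cases (simp_all add: simps star_circ_l_star_circ_r)
  next
    case (sig_sig_tau' i)
    consider "k = i" | "k = Suc i" | "k = Suc (Suc i)" | "k \<noteq> i" "k \<noteq> Suc i" "k \<noteq> Suc (Suc i)"
      by blast
    \<comment> \<open>Acting by generator \<open>i + 2\<close> is distributed over
      \<open>\<circ>\<^sub>l\<close> at \<open>k = Suc i\<close> and over
      \<open>\<circ>\<^sub>r\<close> at \<open>k = Suc (Suc i)\<close>.\<close>
    then show ?thesis
      using sig_sig_tau' k1 by cases (simp_all add: simps circ_l_star circ_r_star)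
  qed
qed (use n in simp)

text \<open>The two cancellation relations, read in the endomorphism monoid, say that the maps for
  \<open>Sig i\<close> and \<open>SigInv i\<close> are mutually inverse.\<close>

lemma letter_endo_Sig_inverse:
  assumes "i \<in> {1..<n}"
  shows letter_endo_Sig_Units: "letter_endo n (Sig i) \<in> Units (sq_End (FSQ n))"
    and inv_letter_endo_Sig: "inv\<^bsub>sq_End (FSQ n)\<^esub> (letter_endo n (Sig i)) = letter_endo n (SigInv i)"
proof -
  have "letter_endo n (Sig i) \<otimes>\<^bsub>sq_End (FSQ n)\<^esub> letter_endo n (SigInv i) = \<one>\<^bsub>sq_End (FSQ n)\<^esub>"
    "letter_endo n (SigInv i) \<otimes>\<^bsub>sq_End (FSQ n)\<^esub> letter_endo n (Sig i) = \<one>\<^bsub>sq_End (FSQ n)\<^esub>"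
    using letter_endo_rel[OF sb_rel.sig_inv[OF assms]] letter_endo_rel[OF sb_rel.inv_sig[OF assms]]
      letter_endo_closed assms by simp_all
  then show "letter_endo n (Sig i) \<in> Units (sq_End (FSQ n))"
    "inv\<^bsub>sq_End (FSQ n)\<^esub> (letter_endo n (Sig i)) = letter_endo n (SigInv i)"
    using letter_endo_closed[of "Sig i"] letter_endo_closed[of "SigInv i"] assms
    by (auto simp: Units_def intro!: E.inv_unique'[symmetric])
qed

end

text \<open>Extensionality fixes the values off the carrier, so that uniqueness can hold. The clause
  on \<open>Units\<close> ensures that \<open>inv\<close> denotes a genuine two-sided
  inverse.\<close>

theorem proposition6p4:
  fixes n :: nat
  assumes "n \<ge> 2"
  shows "\<exists>!\<Phi>. \<Phi> \<in> extensional (carrier (SB n)) \<and>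
    \<Phi> \<in> hom (SB n) (sq_End (FSQ n)) \<and> \<Phi> \<one>\<^bsub>SB n\<^esub> = \<one>\<^bsub>sq_End (FSQ n)\<^esub> \<and>
    (\<forall>i\<in>{1..<n}.
      \<Phi> (sb_class n [Sig i]) (fsq_gen n i) = fsq_gen n (i + 1) \<and>
      \<Phi> (sb_class n [Sig i]) (fsq_gen n (i + 1)) = fsq_gen n i \<star>\<^bsub>FSQ n\<^esub> fsq_gen n (i + 1) \<and>
      (\<forall>j\<in>{1..n} - {i, i + 1}. \<Phi> (sb_class n [Sig i]) (fsq_gen n j) = fsq_gen n j) \<and>
      \<Phi> (sb_class n [Tau i]) (fsq_gen n i) = fsq_gen n i \<circ>\<^sub>l\<^bsub>FSQ n\<^esub> fsq_gen n (i + 1) \<and>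
      \<Phi> (sb_class n [Tau i]) (fsq_gen n (i + 1)) = fsq_gen n i \<circ>\<^sub>r\<^bsub>FSQ n\<^esub> fsq_gen n (i + 1) \<and>
      (\<forall>j\<in>{1..n} - {i, i + 1}. \<Phi> (sb_class n [Tau i]) (fsq_gen n j) = fsq_gen n j) \<and>
      \<Phi> (sb_class n [Sig i]) \<in> Units (sq_End (FSQ n)) \<and>
      \<Phi> (sb_class n [SigInv i]) = inv\<^bsub>sq_End (FSQ n)\<^esub> (\<Phi> (sb_class n [Sig i])))"
  (is "\<exists>!\<Phi>. ?P \<Phi>")
proof -
  interpret oriented_singquandle "FSQ n"
    using assms by (intro oriented_singquandle_FSQ) simp
  interpret E: monoid "sq_End (FSQ n)"
    by (rule monoid_sq_End)
  obtain \<Phi> where \<Phi>: "\<Phi> \<in> extensional (carrier (SB n))" "\<Phi> \<in> hom (SB n) (sq_End (FSQ n))"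
    "\<And>w. w \<in> sb_words n \<Longrightarrow> \<Phi> (sb_class n w) = word_prod (sq_End (FSQ n)) (letter_endo n) w"
    using E.SB_hom_exists[OF letter_endo_Pi[OF assms] letter_endo_rel[OF assms]] by blast
  have one: "\<Phi> \<one>\<^bsub>SB n\<^esub> = \<one>\<^bsub>sq_End (FSQ n)\<^esub>"
    by (simp add: SB_one \<Phi>(3))
  have letter: "\<Phi> (sb_class n [l]) = letter_endo n l" if "sb_index l \<in> {1..<n}" for l
    using that letter_endo_closed[OF assms that] by (simp add: \<Phi>(3))
  show ?thesis
  proof (rule ex1I)
    show "?P \<Phi>"
      using \<Phi>(1,2) one
      by (auto simp: letter letter_endo_gen[OF assms] letter_image_def
          letter_endo_Sig_Units[OF assms] inv_letter_endo_Sig[OF assms])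
  next
    fix \<Psi> assume \<Psi>: "?P \<Psi>"
    have cl: "\<Psi> (sb_class n [l]) \<in> carrier (sq_End (FSQ n))" if "sb_index l \<in> {1..<n}" for l
    proof -
      have "[l] \<in> sb_words n"
        using that by simp
      then have "sb_class n [l] \<in> carrier (SB n)"
        unfolding SB_carrier_iff by blast
      moreover have "\<Psi> \<in> hom (SB n) (sq_End (FSQ n))"
        using \<Psi> by simp
      ultimately show ?thesis
        by (rule hom_in_carrier[rotated])
    qed
    \<comment> \<open>Values on generators are prescribed only for \<open>Sig\<close> and
      \<open>Tau\<close>; the letters \<open>SigInv\<close> follow afterwards, as inverses of images
      already known.\<close>
    have eq: "\<Psi> (sb_class n [l]) = letter_endo n l"
      if l: "sb_index l \<in> {1..<n}" "\<And>i. l \<noteq> SigInv i" for l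
    proof (rule FSQ_End_eqI[OF cl[OF l(1)] letter_endo_closed[OF assms l(1)]])
      show "\<Psi> (sb_class n [l]) (fsq_gen n k) = letter_endo n l (fsq_gen n k)"
        if "k \<in> {1..n}" for k
        using \<Psi> l that
        by (cases l) (auto simp: letter_endo_gen[OF assms] letter_image_def)
    qed (use assms in simp)
    have "\<Psi> (sb_class n [l]) = letter_endo n l" if l: "sb_index l \<in> {1..<n}" for l
    proof (cases l)
      case (SigInv i)
      then have "\<Psi> (sb_class n [l]) = inv\<^bsub>sq_End (FSQ n)\<^esub> (\<Psi> (sb_class n [Sig i]))"
        using \<Psi> l by simp
      also have "\<dots> = letter_endo n l"
        using SigInv l by (simp add: eq inv_letter_endo_Sig[OF assms])
      finally show ?thesis .
    qed (use eq l in auto)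
    then show "\<Psi> = \<Phi>"
      using \<Psi> \<Phi> one letter by (intro SB_hom_eqI[of \<Psi> n "sq_End (FSQ n)" \<Phi>]) auto
  qed
qed

end
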